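(* For every fixed $\varepsilon>0$ there exists an instance of the MST-interdiction problem (for which the index $k$ below exists) such that $\mathrm{UB}/\mathrm{OPT}\ge 3-\varepsilon$.
   Context: MST-interdiction problem: the input is a multigraph $G=(V,E)$, edge weights $w_e\ge 0$, interdiction costs $c_e\ge 0$, and a budget $B\ge 0$. For $F\subseteq E$ let $c(F)=\sum_{e\in F}c_e$. For $R\subseteq E$, $\mathrm{val}(R)$ is the minimum $w$-weight of a spanning tree of $(V,E\setminus R)$ ($\infty$ if disconnected), and $\mathrm{OPT}=\max\{\mathrm{val}(R): R\subseteq E, c(R)\le B\}$. Let $w_1<w_2<\dots<w_M$ be the distinct values in $\{w_e:e\in E\}$ and $E_{\le i}=\{e\in E: w_e\le w_i\}$. Let $k\in\{1,\dots,M\}$ be the smallest index such that $(V,E_{\le k}\setminus R)$ is connected for every $R\subseteq E$ with $c(R)\le B$. For $\lambda\ge 0$ and $R\subseteq E_{\le k-1}$ let $f_\lambda(R)=\mathrm{val}(R)-\lambda c(R)$, and define $\mathrm{UB}=\min_{\lambda\ge 0}\bigl(\lambda B+\max_{R\subseteq E_{\le k-1}} f_\lambda(R)\bigr)$. *)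

theory Defs
  imports Complex_Main "HOL-Library.Extended_Real"
begin

text \<open>
  An undirected multigraph has an abstract set of edges, each with a set of one (loop) or two end
  vertices, so parallel edges are distinct elements with the same ends.  For a fixed end map, the
  subgraph \<open>(V, F)\<close> is given by its edge set \<open>F\<close>.
\<close>

record ('v, 'e) mst_interdiction =
  verts :: "'v set"
  edges :: "'e set"
  ends :: "'e \<Rightarrow> 'v set"
  weight :: "'e \<Rightarrow> real"
  cost :: "'e \<Rightarrow> real"
  budget :: real

definition is_instance :: "('v, 'e) mst_interdiction \<Rightarrow> bool" where
  "is_instance I \<longleftrightarrow>
     finite (verts I) \<and> verts I \<noteq> {} \<and> finite (edges I) \<and>
     (\<forall>e\<in>edges I. ends I e \<subseteq> verts I \<and> card (ends I e) \<in> {1, 2}) \<and>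
     (\<forall>e\<in>edges I. 0 \<le> weight I e \<and> 0 \<le> cost I e) \<and>
     0 \<le> budget I"

definition adjacency :: "('e \<Rightarrow> 'v set) \<Rightarrow> 'e set \<Rightarrow> ('v \<times> 'v) set" where
  "adjacency en F = {(u, v). \<exists>e\<in>F. en e = {u, v}}"

definition graph_connected :: "'v set \<Rightarrow> ('e \<Rightarrow> 'v set) \<Rightarrow> 'e set \<Rightarrow> bool" where
  "graph_connected V en F \<longleftrightarrow> (\<forall>u\<in>V. \<forall>v\<in>V. (u, v) \<in> (adjacency en F)\<^sup>*)"

text \<open>Cycles of length 1 are loops, cycles of length 2 are pairs of parallel edges.\<close>

definition is_cycle :: "('e \<Rightarrow> 'v set) \<Rightarrow> 'e set \<Rightarrow> 'v list \<Rightarrow> 'e list \<Rightarrow> bool" where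
  "is_cycle en F vs es \<longleftrightarrow>
     es \<noteq> [] \<and> length vs = length es \<and> distinct vs \<and> distinct es \<and> set es \<subseteq> F \<and>
     (\<forall>i<length es. en (es ! i) = {vs ! i, vs ! (Suc i mod length es)})"

definition spanning_tree :: "'v set \<Rightarrow> ('e \<Rightarrow> 'v set) \<Rightarrow> 'e set \<Rightarrow> 'e set \<Rightarrow> bool" where
  "spanning_tree V en F T \<longleftrightarrow>
     T \<subseteq> F \<and> graph_connected V en T \<and> \<not> (\<exists>vs es. is_cycle en T vs es)"

definition total_cost :: "('v, 'e) mst_interdiction \<Rightarrow> 'e set \<Rightarrow> real" where
  "total_cost I F = (\<Sum>e\<in>F. cost I e)"

text \<open>The infimum over the empty set of spanning trees is \<open>\<infinity>\<close>.\<close>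

definition val :: "('v, 'e) mst_interdiction \<Rightarrow> 'e set \<Rightarrow> ereal" where
  "val I R =
     (INF T \<in> {T. spanning_tree (verts I) (ends I) (edges I - R) T}. ereal (\<Sum>e\<in>T. weight I e))"

definition OPT :: "('v, 'e) mst_interdiction \<Rightarrow> ereal" where
  "OPT I = Max (val I ` {R. R \<subseteq> edges I \<and> total_cost I R \<le> budget I})"

definition num_weights :: "('v, 'e) mst_interdiction \<Rightarrow> nat" where
  "num_weights I = card (weight I ` edges I)"

definition nth_weight :: "('v, 'e) mst_interdiction \<Rightarrow> nat \<Rightarrow> real" where
  "nth_weight I i = sorted_list_of_set (weight I ` edges I) ! (i - 1)"

text \<open>Weights are indexed from 1; index 0 gives the empty edge set.\<close>

definition edges_upto :: "('v, 'e) mst_interdiction \<Rightarrow> nat \<Rightarrow> 'e set" where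
  "edges_upto I i = (if i = 0 then {} else {e \<in> edges I. weight I e \<le> nth_weight I i})"

definition unbreakable :: "('v, 'e) mst_interdiction \<Rightarrow> nat \<Rightarrow> bool" where
  "unbreakable I i \<longleftrightarrow>
     (\<forall>R. R \<subseteq> edges I \<and> total_cost I R \<le> budget I \<longrightarrow>
        graph_connected (verts I) (ends I) (edges_upto I i - R))"

definition is_critical_index :: "('v, 'e) mst_interdiction \<Rightarrow> nat \<Rightarrow> bool" where
  "is_critical_index I k \<longleftrightarrow>
     k \<in> {1..num_weights I} \<and> unbreakable I k \<and> (\<forall>j\<in>{1..<k}. \<not> unbreakable I j)"

definition lagrangian :: "('v, 'e) mst_interdiction \<Rightarrow> real \<Rightarrow> 'e set \<Rightarrow> ereal" where
  "lagrangian I l R = val I R - ereal (l * total_cost I R)"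

definition dual_value :: "('v, 'e) mst_interdiction \<Rightarrow> nat \<Rightarrow> real \<Rightarrow> ereal" where
  "dual_value I k l =
     ereal (l * budget I) + Max (lagrangian I l ` {R. R \<subseteq> edges_upto I (k - 1)})"

definition UB :: "('v, 'e) mst_interdiction \<Rightarrow> nat \<Rightarrow> ereal" where
  "UB I k = (INF l \<in> {0..}. dual_value I k l)"

text \<open>The infimum is always attained, so \<open>UB\<close> is a minimum.\<close>

lemma affine_max_attains_inf:
  fixes a s :: "'a \<Rightarrow> real"
  assumes fin: "finite F" and r0: "r \<in> F" "0 \<le> s r"
  shows "\<exists>l\<ge>0. \<forall>m\<ge>0. Max ((\<lambda>R. a R + l * s R) ` F) \<le> Max ((\<lambda>R. a R + m * s R) ` F)"
proof -
  define g where "g l = Max ((\<lambda>R. a R + l * s R) ` F)" for l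
  have ne: "F \<noteq> {}" using r0 by auto
  have ge: "a R + l * s R \<le> g l" if "R \<in> F" for R l
    unfolding g_def using fin that by (intro Max_ge) auto
  have cont: "continuous_on S g" for S
  proof -
    have "continuous_on S (\<lambda>l. Max ((\<lambda>R. a R + l * s R) ` F))"
      using fin ne
    proof (induction F rule: finite_ne_induct)
      case (singleton x)
      then show ?case by (auto intro!: continuous_intros)
    next
      case (insert x F)
      have "(\<lambda>l. Max ((\<lambda>R. a R + l * s R) ` insert x F)) =
            (\<lambda>l. max (a x + l * s x) (Max ((\<lambda>R. a R + l * s R) ` F)))"
        using insert by (auto simp: Max_insert)
      then show ?case using insert by (auto intro!: continuous_intros continuous_on_max)
    qed
    then show ?thesis unfolding g_def .
  qed
  define N where "N = {R \<in> F. s R < 0}"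
  define L where "L = Max (insert 0 ((\<lambda>R. (a R - a r) / (- s R)) ` N))"
  have finN: "finite N" using fin by (simp add: N_def)
  have L0: "0 \<le> L" unfolding L_def using finN by (intro Max_ge) auto
  have LN: "(a R - a r) / (- s R) \<le> L" if "R \<in> N" for R
    unfolding L_def using finN that by (intro Max_ge) auto
  have mono: "g L \<le> g m" if m: "L \<le> m" for m
  proof -
    have "a R + L * s R \<le> g m" if R: "R \<in> F" for R
    proof (cases "s R < 0")
      case True
      with R have "(a R - a r) / (- s R) \<le> L" by (intro LN) (simp add: N_def)
      with True have "a R - a r \<le> L * (- s R)" by (subst (asm) pos_divide_le_eq) auto
      then have "a R + L * s R \<le> a r" by simp
      also have "\<dots> \<le> a r + m * s r" using m L0 r0 by simp
      also have "\<dots> \<le> g m" using r0 by (intro ge)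
      finally show ?thesis .
    next
      case False
      then have "a R + L * s R \<le> a R + m * s R" using m by (simp add: mult_right_mono)
      also have "\<dots> \<le> g m" using R by (intro ge)
      finally show ?thesis .
    qed
    then show ?thesis unfolding g_def[of L] using fin ne by (subst Max_le_iff) auto
  qed
  obtain l where l: "l \<in> {0..L}" "\<forall>m\<in>{0..L}. g l \<le> g m"
    using continuous_attains_inf[of "{0..L}" g] cont L0 by auto
  have "g l \<le> g m" if "0 \<le> m" for m
  proof (cases "m \<le> L")
    case True
    with l that show ?thesis by auto
  next
    case False
    have "g l \<le> g L" using l L0 by auto
    with mono[of m] False show ?thesis by auto
  qed
  with l show ?thesis unfolding g_def by auto
qed

lemma UB_attained:
  assumes "is_instance I"
  shows "\<exists>l\<ge>0. UB I k = dual_value I k l \<and> (\<forall>m\<ge>0. dual_value I k l \<le> dual_value I k m)"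
proof -
  define F where "F = {R. R \<subseteq> edges_upto I (k - 1)}"
  have finE: "finite (edges_upto I (k - 1))"
    using assms by (auto simp: edges_upto_def is_instance_def)
  then have finF: "finite F" by (simp add: F_def)
  have empF: "{} \<in> F" by (simp add: F_def)
  have val0: "0 \<le> val I R" for R
    unfolding val_def
  proof (rule INF_greatest)
    fix T assume "T \<in> {T. spanning_tree (verts I) (ends I) (edges I - R) T}"
    then have "T \<subseteq> edges I" by (auto simp: spanning_tree_def)
    with assms have "0 \<le> (\<Sum>e\<in>T. weight I e)"
      by (intro sum_nonneg) (auto simp: is_instance_def)
    then show "0 \<le> ereal (\<Sum>e\<in>T. weight I e)" by simp
  qed
  have "\<exists>l\<ge>0. \<forall>m\<ge>0. dual_value I k l \<le> dual_value I k m"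
  proof (cases "\<exists>R\<in>F. val I R = \<infinity>")
    case True
    then obtain R where R: "R \<in> F" "val I R = \<infinity>" by blast
    have "dual_value I k l = \<infinity>" for l
    proof -
      have "lagrangian I l R \<le> Max (lagrangian I l ` F)"
        using R finF by (intro Max_ge) auto
      with R have "Max (lagrangian I l ` F) = \<infinity>" by (simp add: lagrangian_def)
      then show ?thesis by (simp add: dual_value_def F_def)
    qed
    then show ?thesis by (intro exI[of _ 0]) auto
  next
    case False
    define a where "a R = real_of_ereal (val I R)" for R
    define s where "s R = budget I - total_cost I R" for R
    have va: "val I R = ereal (a R)" if "R \<in> F" for R
      using False that val0[of R] by (cases "val I R") (auto simp: a_def)
    have dv: "dual_value I k l = ereal (Max ((\<lambda>R. a R + l * s R) ` F))" for l
    proof -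
      have mono: "mono ereal" by (auto simp: mono_def)
      have "lagrangian I l ` F = ereal ` ((\<lambda>R. a R - l * total_cost I R) ` F)"
        using va by (auto simp: lagrangian_def image_image intro!: image_cong)
      moreover have "Max (ereal ` ((\<lambda>R. a R - l * total_cost I R) ` F)) =
          ereal (Max ((\<lambda>R. a R - l * total_cost I R) ` F))"
        using finF empF by (intro mono_Max_commute[OF mono, symmetric]) auto
      moreover have "l * budget I + Max ((\<lambda>R. a R - l * total_cost I R) ` F) =
          Max ((\<lambda>x. l * budget I + x) ` ((\<lambda>R. a R - l * total_cost I R) ` F))"
        using finF empF by (intro mono_Max_commute) (auto simp: mono_def)
      ultimately show ?thesis
        unfolding dual_value_def F_def[symmetric]
        by (simp add: image_image s_def algebra_simps)
    qed
    have "0 \<le> s {}" using assms by (simp add: s_def total_cost_def is_instance_def)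
    from affine_max_attains_inf[where a = a and s = s, OF finF empF this] show ?thesis by (simp add: dv)
  qed
  then obtain l where l: "l \<ge> 0" "\<forall>m\<ge>0. dual_value I k l \<le> dual_value I k m" by blast
  then have "UB I k = dual_value I k l"
    unfolding UB_def by (intro antisym INF_lower INF_greatest) auto
  with l show ?thesis by blast
qed

end

theory Submission
  imports Defs
begin

text \<open>
  Take a cycle on \<open>n\<close> vertices whose edges have weight 0 and cost 1, add a parallel edge of weight 1
  and cost 3 to each of them, and let the budget be slightly less than 3.  Then no edge of weight 1
  and at most two edges of weight 0 can be interdicted, so that \<open>OPT = 1\<close>.  On the other hand,
  interdicting all cycle edges costs \<open>n\<close> and yields \<open>n - 1\<close>, so the Lagrangian relaxation may
  interdict them at an average rate of \<open>(n - 1) / n\<close> per unit of budget.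
\<close>

subsection \<open>Connected subgraphs and spanning trees\<close>

lemma sym_adjacency: "sym (adjacency en F)"
  by (auto simp: sym_def adjacency_def insert_commute)

lemma graph_connected_mono:
  assumes "graph_connected V en F" "F \<subseteq> F'"
  shows "graph_connected V en F'"
proof -
  have "(adjacency en F)\<^sup>* \<subseteq> (adjacency en F')\<^sup>*"
    using assms(2) by (intro rtrancl_mono) (auto simp: adjacency_def)
  with assms(1) show ?thesis by (auto simp: graph_connected_def)
qed

text \<open>The rest of the cycle is a path between the ends of the removed edge, so walks can be
  rerouted along it. For a loop this path is trivial.\<close>

lemma graph_connected_remove_cycle_edge:
  assumes conn: "graph_connected V en F" and cyc: "is_cycle en F vs es"
  shows "graph_connected V en (F - {es ! 0})"
proof -
  let ?A = "adjacency en (F - {es ! 0})" and ?m = "length es"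
  have m: "?m > 0" and d: "distinct es" and sub: "set es \<subseteq> F"
    and en: "\<And>i. i < ?m \<Longrightarrow> en (es ! i) = {vs ! i, vs ! (Suc i mod ?m)}"
    using cyc by (auto simp: is_cycle_def)
  have symA: "sym (?A\<^sup>*)" by (intro sym_rtrancl sym_adjacency)
  have step: "(vs ! i, vs ! (Suc i mod ?m)) \<in> ?A" if "0 < i" "i < ?m" for i
  proof -
    have "es ! i \<noteq> es ! 0" using d that m by (simp add: nth_eq_iff_index_eq)
    moreover have "es ! i \<in> F" using sub that by auto
    ultimately show ?thesis using en[OF that(2)] by (auto simp: adjacency_def)
  qed
  have walk: "(vs ! (1 mod ?m), vs ! (Suc i mod ?m)) \<in> ?A\<^sup>*" if "i < ?m" for i
    using that
  proof (induction i)
    case (Suc i)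
    have "(vs ! (Suc i mod ?m), vs ! (Suc (Suc i) mod ?m)) \<in> ?A"
      using step[of "Suc i"] Suc.prems by simp
    with Suc show ?case by (simp add: rtrancl.rtrancl_into_rtrancl)
  qed simp
  \<comment> \<open>At the last index the successor wraps around to 0, which closes the
    detour.\<close>
  have ends: "(vs ! (1 mod ?m), vs ! 0) \<in> ?A\<^sup>*"
    using walk[of "?m - 1"] m by simp
  have "adjacency en F \<subseteq> ?A\<^sup>*"
  proof
    fix p assume "p \<in> adjacency en F"
    then obtain u v e where p: "p = (u, v)" "e \<in> F" "en e = {u, v}"
      by (auto simp: adjacency_def)
    show "p \<in> ?A\<^sup>*"
    proof (cases "e = es ! 0")
      case True
      with en[of 0] m p have "{u, v} = {vs ! 0, vs ! (1 mod ?m)}" by simp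
      with ends symA p show ?thesis by (auto simp: doubleton_eq_iff dest: symD)
    next
      case False
      with p show ?thesis by (auto simp: adjacency_def)
    qed
  qed
  then have "(adjacency en F)\<^sup>* \<subseteq> ?A\<^sup>*" by (rule rtrancl_subset_rtrancl)
  with conn show ?thesis by (auto simp: graph_connected_def)
qed

text \<open>Deleting one edge of a cycle at a time keeps the graph connected and terminates because
  \<open>F\<close> is finite.\<close>

lemma connected_contains_spanning_tree:
  assumes "finite F" "graph_connected V en F"
  shows "\<exists>T. spanning_tree V en F T"
  using assms
proof (induction F rule: finite_psubset_induct)
  case (psubset F)
  show ?case
  proof (cases "\<exists>vs es. is_cycle en F vs es")
    case True
    then obtain vs es where cyc: "is_cycle en F vs es" by blast
    then have "es ! 0 \<in> F" by (auto simp: is_cycle_def)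
    then have "F - {es ! 0} \<subset> F" by blast
    with psubset.IH graph_connected_remove_cycle_edge[OF psubset.prems cyc]
    obtain T where "spanning_tree V en (F - {es ! 0}) T" by blast
    then show ?thesis by (auto simp: spanning_tree_def)
  next
    case False
    with psubset.prems show ?thesis by (auto simp: spanning_tree_def)
  qed
qed

text \<open>Weights are nonnegative, so passing from \<open>F\<close> to a spanning tree inside it
  does not increase the weight. Upper bounds on \<open>val\<close> thus only require a connected
  witness.\<close>

lemma val_le_weight_of_connected:
  assumes inst: "is_instance I" and F: "F \<subseteq> edges I - R"
    and conn: "graph_connected (verts I) (ends I) F"
  shows "val I R \<le> ereal (\<Sum>e\<in>F. weight I e)"
proof -
  have fin: "finite F"
    using inst F by (meson Diff_subset finite_subset is_instance_def)
  obtain T where T: "spanning_tree (verts I) (ends I) F T"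
    using connected_contains_spanning_tree[OF fin conn] by blast
  then have "spanning_tree (verts I) (ends I) (edges I - R) T"
    using F by (auto simp: spanning_tree_def)
  then have "val I R \<le> ereal (\<Sum>e\<in>T. weight I e)"
    unfolding val_def by (intro INF_lower) simp
  also have "(\<Sum>e\<in>T. weight I e) \<le> (\<Sum>e\<in>F. weight I e)"
    using T F inst fin by (intro sum_mono2) (auto simp: spanning_tree_def is_instance_def)
  finally show ?thesis by simp
qed

text \<open>Lower bounds on \<open>val\<close> are reduced to connected edge sets, a class
  containing all spanning trees.\<close>

lemma val_geI:
  assumes "\<And>T. \<lbrakk>T \<subseteq> edges I - R; graph_connected (verts I) (ends I) T\<rbrakk>
    \<Longrightarrow> c \<le> (\<Sum>e\<in>T. weight I e)"
  shows "ereal c \<le> val I R"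
  unfolding val_def using assms by (intro INF_greatest) (auto simp: spanning_tree_def)

subsection \<open>Cycles with parallel edges\<close>

text \<open>Reading labels modulo \<open>n\<close> makes \<open>e\<close> and \<open>n + e\<close>
  parallel: below, labels less than \<open>n\<close> are the light copies and \<open>n\<close>, ...,
  \<open>2 * n - 1\<close> the heavy ones. The position of \<open>e\<close> on the cycle is
  \<open>e mod n\<close>.\<close>

definition cycle_ends :: "nat \<Rightarrow> nat \<Rightarrow> nat set" where
  "cycle_ends n e = {e mod n, Suc e mod n}"

text \<open>A cycle without position \<open>j\<close> is still a path, running from vertex
  \<open>j + 1\<close> around to vertex \<open>j\<close>.\<close>

lemma cycle_connectedI:
  assumes n: "0 < n" and j: "j < n"
    and cover: "\<And>i. \<lbrakk>i < n; i \<noteq> j\<rbrakk> \<Longrightarrow> i \<in> (\<lambda>e. e mod n) ` F"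
  shows "graph_connected {..<n} (cycle_ends n) F"
proof -
  let ?A = "adjacency (cycle_ends n) F"
  have symA: "sym (?A\<^sup>*)" by (intro sym_rtrancl sym_adjacency)
  have step: "(i mod n, Suc i mod n) \<in> ?A" if "i mod n \<noteq> j" for i
  proof -
    from cover[of "i mod n"] that n obtain e where e: "e \<in> F" "i mod n = e mod n" by auto
    then have "Suc i mod n = Suc e mod n" by (metis mod_Suc_eq)
    with e show ?thesis by (auto simp: adjacency_def cycle_ends_def)
  qed
  have walk: "(Suc j mod n, (Suc j + m) mod n) \<in> ?A\<^sup>*" if "m < n" for m
    using that
  proof (induction m)
    case (Suc m)
    have "(Suc j + m) mod n \<noteq> j"
    proof
      assume "(Suc j + m) mod n = j"
      then have "(j + Suc m) mod n = (j + 0) mod n" using j by simp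
      then have "n dvd Suc m" using mod_eq_dvd_iff_nat[of "j + 0" "j + Suc m" n] by simp
      with Suc.prems show False by (auto dest: dvd_imp_le)
    qed
    from step[OF this] Suc show ?case by (simp add: rtrancl.rtrancl_into_rtrancl)
  qed simp
  have reach: "(Suc j mod n, v) \<in> ?A\<^sup>*" if v: "v < n" for v
  proof (cases "Suc j \<le> v")
    case True
    with walk[of "v - Suc j"] v show ?thesis by simp
  next
    case False
    \<comment> \<open>Vertices up to \<open>j\<close> are reached only after the walk passes through
      0, hence the extra \<open>n\<close>.\<close>
    with walk[of "n + v - Suc j"] v j show ?thesis by simp
  qed
  show ?thesis
    unfolding graph_connected_def
    using reach symA by (auto intro: rtrancl_trans dest: symD)
qed

text \<open>Two missing positions cut the cycle into the arc \<open>{Suc i..j}\<close> and its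
  complement, and only edges at positions \<open>i\<close> and \<open>j\<close> cross this
  cut.\<close>

lemma cycle_connectedD:
  assumes conn: "graph_connected {..<n} (cycle_ends n) F" and ij: "i < j" "j < n"
  shows "i \<in> (\<lambda>e. e mod n) ` F \<or> j \<in> (\<lambda>e. e mod n) ` F"
proof (rule ccontr)
  assume no: "\<not> ?thesis"
  let ?A = "adjacency (cycle_ends n) F"
  have cut: "e mod n \<in> {Suc i..j} \<longleftrightarrow> Suc e mod n \<in> {Suc i..j}" if "e \<in> F" for e
  proof -
    have "e mod n \<noteq> i" "e mod n \<noteq> j" using no that by auto
    moreover have "e mod n < n" using ij by (intro mod_less_divisor) linarith
    ultimately show ?thesis using ij by (auto simp: mod_Suc)
  qed
  have closed: "v \<in> {Suc i..j}" if "(u, v) \<in> ?A" "u \<in> {Suc i..j}" for u v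
  proof -
    from that(1) obtain e where "e \<in> F" "{e mod n, Suc e mod n} = {u, v}"
      by (auto simp: adjacency_def cycle_ends_def)
    with cut[of e] that(2) show ?thesis unfolding doubleton_eq_iff by metis
  qed
  have reach: "v \<in> {Suc i..j}" if "(j, v) \<in> ?A\<^sup>*" for v
    using that
  proof (induction rule: rtrancl_induct)
    case base
    then show ?case using ij by simp
  next
    case (step u v)
    from closed[OF step.hyps(2) step.IH] show ?case .
  qed
  have "(j, i) \<in> ?A\<^sup>*" using conn ij by (auto simp: graph_connected_def)
  from reach[OF this] show False by simp
qed

text \<open>At most one position is left uncovered, and each edge covers exactly one
  position.\<close>

lemma cycle_connected_card:
  assumes conn: "graph_connected {..<n} (cycle_ends n) F" and fin: "finite F"
  shows "n - 1 \<le> card F"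
proof -
  let ?C = "(\<lambda>e. e mod n) ` F"
  have "card ({..<n} - ?C) \<le> 1"
  proof (rule ccontr)
    assume "\<not> ?thesis"
    then have "2 \<le> card ({..<n} - ?C)" by simp
    then obtain i j where "i \<noteq> j" "i \<in> {..<n} - ?C" "j \<in> {..<n} - ?C"
      by (metis card_le_Suc0_iff_eq finite_Diff finite_lessThan not_less_eq_eq numeral_2_eq_2)
    with cycle_connectedD[OF conn, of i j] cycle_connectedD[OF conn, of j i]
    show False by (cases "i < j") auto
  qed
  moreover have "n - card ?C \<le> card ({..<n} - ?C)"
    using diff_card_le_card_Diff[of ?C "{..<n}"] fin by simp
  moreover have "card ?C \<le> card F" using fin by (rule card_image_le)
  ultimately show ?thesis by linarith
qed

subsection \<open>The gap instance\<close>

text \<open>The budget stays strictly below 3, the price of one heavy or three light edges, tends to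
  3, and is at least 2 once \<open>n\<close> is at least 3.\<close>

definition gap_instance :: "nat \<Rightarrow> (nat, nat) mst_interdiction" where
  "gap_instance n = \<lparr>verts = {..<n}, edges = {..<2 * n}, ends = cycle_ends n,
     weight = (\<lambda>e. if e < n then 0 else 1), cost = (\<lambda>e. if e < n then 1 else 3),
     budget = 3 - 3 / real n\<rparr>"

lemma gap_instance_simps [simp]:
  "verts (gap_instance n) = {..<n}"
  "edges (gap_instance n) = {..<2 * n}"
  "ends (gap_instance n) = cycle_ends n"
  "weight (gap_instance n) e = (if e < n then 0 else 1)"
  "cost (gap_instance n) e = (if e < n then 1 else 3)"
  "budget (gap_instance n) = 3 - 3 / real n"
  by (simp_all add: gap_instance_def)

context
  fixes n :: nat
  assumes n3: "3 \<le> n"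
begin

lemma is_instance_gap_instance: "is_instance (gap_instance n)"
proof -
  have "card (cycle_ends n e) = Suc 0 \<or> card (cycle_ends n e) = 2" for e
    by (auto simp: cycle_ends_def card_insert_if)
  then show ?thesis
    using n3 by (auto simp: is_instance_def cycle_ends_def field_simps lessThan_empty_iff)
qed

lemma gap_instance_weight_sum:
  assumes "finite F"
  shows "(\<Sum>e\<in>F. weight (gap_instance n) e) = real (card (F - {..<n}))"
  using assms by (simp add: sum.If_cases Diff_eq Compl_eq lessThan_def)

lemma gap_instance_feasible:
  assumes R: "R \<subseteq> {..<2 * n}" and c: "total_cost (gap_instance n) R \<le> 3 - 3 / real n"
  shows "R \<subseteq> {..<n}" "card R \<le> 2"
proof -
  have fin: "finite R" using R finite_subset by blast
  have lt: "total_cost (gap_instance n) R < 3"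
  proof -
    have "3 / real n > 0" using n3 by simp
    with c show ?thesis by linarith
  qed
  show sub: "R \<subseteq> {..<n}"
  proof
    fix e assume e: "e \<in> R"
    have "cost (gap_instance n) e \<le> total_cost (gap_instance n) R"
      unfolding total_cost_def using e fin by (intro member_le_sum) auto
    with lt show "e \<in> {..<n}" by (auto split: if_splits)
  qed
  have "total_cost (gap_instance n) R = (\<Sum>e\<in>R. 1)"
    unfolding total_cost_def using sub by (intro sum.cong) auto
  with lt show "card R \<le> 2" by simp
qed

text \<open>No affordable set meets the heavy cycle, so this one witness yields both finite values
  and the unbreakability of index 2.\<close>

lemma heavy_cycle_connected: "graph_connected {..<n} (cycle_ends n) {n..<2 * n}"
proof (rule cycle_connectedI[of n 0])
  fix i assume "i < n"
  then show "i \<in> (\<lambda>e. e mod n) ` {n..<2 * n}"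
    by (intro image_eqI[of _ _ "n + i"]) auto
qed (use n3 in auto)

section \<open>Values of interdiction sets and the optimum\<close>

lemma val_gap_instance_finite:
  assumes "R \<subseteq> {..<n}"
  shows "val (gap_instance n) R < \<infinity>"
proof -
  have "{n..<2 * n} \<subseteq> edges (gap_instance n) - R" using assms by auto
  with heavy_cycle_connected is_instance_gap_instance show ?thesis
    by (intro le_less_trans[OF val_le_weight_of_connected]) auto
qed

text \<open>One removed position may stay open; the other is repaired by a single heavy edge of
  weight 1.\<close>

lemma val_gap_instance_le:
  assumes R: "R \<subseteq> {..<n}" "card R \<le> 2"
  shows "val (gap_instance n) R \<le> 1"
proof -
  have fin: "finite R" using R finite_subset by blast
  \<comment> \<open>Position \<open>i\<close> gets the heavy copy and \<open>j\<close> stays open;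
    they may coincide when \<open>R\<close> has fewer than two elements.\<close>
  obtain i j where ij: "i < n" "j < n" "R \<subseteq> {i, j}"
  proof -
    consider "R = {}" | x where "R = {x}" | x y where "R = {x, y}"
      using R(2) fin
      by (metis One_nat_def card_0_eq card_1_singletonE card_2_iff le_Suc_eq le_zero_eq
          numeral_2_eq_2)
    then show ?thesis
    proof cases
      case 1
      then show ?thesis using that[of 0 0] n3 by auto
    next
      case (2 x)
      then show ?thesis using that[of x x] R by auto
    next
      case (3 x y)
      then show ?thesis using that[of x y] R by auto
    qed
  qed
  let ?F = "insert (n + i) ({..<n} - R)"
  have "graph_connected {..<n} (cycle_ends n) ?F"
  proof (rule cycle_connectedI[of n j])
    fix l assume l: "l < n" "l \<noteq> j"
    show "l \<in> (\<lambda>e. e mod n) ` ?F"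
    proof (cases "l = i")
      case True
      with l show ?thesis by (intro image_eqI[of _ _ "n + i"]) auto
    next
      case False
      with l ij show ?thesis by (intro image_eqI[of _ _ l]) auto
    qed
  qed (use ij in auto)
  moreover have "?F \<subseteq> edges (gap_instance n) - R" using R ij by auto
  ultimately have "val (gap_instance n) R \<le> ereal (\<Sum>e\<in>?F. weight (gap_instance n) e)"
    using is_instance_gap_instance by (intro val_le_weight_of_connected) auto
  also have "(\<Sum>e\<in>?F. weight (gap_instance n) e) = 1"
  proof -
    have "?F - {..<n} = {n + i}" by auto
    then show ?thesis by (subst gap_instance_weight_sum) auto
  qed
  finally show ?thesis by (simp add: one_ereal_def)
qed

text \<open>Positions 0 and 1 cannot both stay open, and only heavy edges are left to cover
  them.\<close>

lemma val_gap_instance_two_edges: "1 \<le> val (gap_instance n) {0, 1}"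
proof -
  have "ereal 1 \<le> val (gap_instance n) {0, 1}"
  proof (rule val_geI)
    fix T assume T: "T \<subseteq> edges (gap_instance n) - {0, 1}"
      "graph_connected (verts (gap_instance n)) (ends (gap_instance n)) T"
    have fin: "finite T" using T(1) by (rule finite_subset) simp
    have "T - {..<n} \<noteq> {}"
    proof
      assume "T - {..<n} = {}"
      \<comment> \<open>Light labels equal their positions, so an all-light \<open>T\<close> misses
        positions 0 and 1.\<close>
      then have "(\<lambda>e. e mod n) ` T = T" by (force simp: image_iff)
      with cycle_connectedD[of n T 0 1] T n3 show False by auto
    qed
    then have "1 \<le> card (T - {..<n})" using fin by (simp add: Suc_le_eq card_gt_0_iff)
    then show "1 \<le> (\<Sum>e\<in>T. weight (gap_instance n) e)"
      using gap_instance_weight_sum[OF fin] by simp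
  qed
  then show ?thesis by (simp add: one_ereal_def)
qed

lemma val_gap_instance_all_light: "ereal (real n - 1) \<le> val (gap_instance n) {..<n}"
proof (rule val_geI)
  fix T assume T: "T \<subseteq> edges (gap_instance n) - {..<n}"
    "graph_connected (verts (gap_instance n)) (ends (gap_instance n)) T"
  have fin: "finite T" using T(1) by (rule finite_subset) simp
  have "n - 1 \<le> card T" using cycle_connected_card[of n T] T fin by simp
  moreover have "T - {..<n} = T" using T(1) by auto
  ultimately show "real n - 1 \<le> (\<Sum>e\<in>T. weight (gap_instance n) e)"
    using gap_instance_weight_sum[OF fin] n3 by simp
qed

lemma two_light_edges_feasible: "total_cost (gap_instance n) {0, 1} \<le> 3 - 3 / real n"
  using n3 by (simp add: total_cost_def field_simps)

lemma OPT_gap_instance: "OPT (gap_instance n) = 1"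
proof -
  let ?Q = "{R. R \<subseteq> edges (gap_instance n) \<and>
    total_cost (gap_instance n) R \<le> budget (gap_instance n)}"
  have fin: "finite ?Q" by (rule finite_subset[of _ "Pow {..<2 * n}"]) auto
  have le: "val (gap_instance n) R \<le> 1" if "R \<in> ?Q" for R
    using that gap_instance_feasible[of R] by (intro val_gap_instance_le) auto
  have mem: "{0, 1} \<in> ?Q" using two_light_edges_feasible n3 by auto
  have "val (gap_instance n) {0, 1} = 1"
    using le[OF mem] val_gap_instance_two_edges by (rule antisym)
  then have "1 \<in> val (gap_instance n) ` ?Q" using mem by (metis imageI)
  then show ?thesis unfolding OPT_def using fin le by (intro Max_eqI) auto
qed

section \<open>Weight levels and the critical index\<close>

lemma gap_instance_weights: "weight (gap_instance n) ` edges (gap_instance n) = {0, 1}"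
proof -
  have "0 \<in> weight (gap_instance n) ` edges (gap_instance n)"
    using n3 by (intro image_eqI[of _ _ 0]) auto
  moreover have "1 \<in> weight (gap_instance n) ` edges (gap_instance n)"
    using n3 by (intro image_eqI[of _ _ n]) auto
  ultimately show ?thesis by auto
qed

text \<open>With critical index 2, the relaxation ranges over the sets of light edges, which form
  level 1.\<close>

lemma gap_instance_edges_upto:
  "edges_upto (gap_instance n) 1 = {..<n}" "edges_upto (gap_instance n) 2 = {..<2 * n}"
  using gap_instance_weights by (auto simp: edges_upto_def nth_weight_def split: if_splits)

lemma gap_instance_critical_index: "is_critical_index (gap_instance n) 2"
proof -
  have "unbreakable (gap_instance n) 2"
    unfolding unbreakable_def
  proof (intro allI impI)
    fix R assume "R \<subseteq> edges (gap_instance n) \<and>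
      total_cost (gap_instance n) R \<le> budget (gap_instance n)"
    then have "R \<subseteq> {..<n}" using gap_instance_feasible[of R] by simp
    then have "{n..<2 * n} \<subseteq> {..<2 * n} - R" by auto
    with heavy_cycle_connected show "graph_connected (verts (gap_instance n))
        (ends (gap_instance n)) (edges_upto (gap_instance n) 2 - R)"
      unfolding gap_instance_edges_upto by (auto intro: graph_connected_mono)
  qed
  moreover have "\<not> unbreakable (gap_instance n) 1"
  proof
    assume "unbreakable (gap_instance n) 1"
    then have "graph_connected {..<n} (cycle_ends n) ({..<n} - {0, 1})"
      using two_light_edges_feasible n3 gap_instance_edges_upto(1) by (auto simp: unbreakable_def)
    from cycle_connectedD[OF this, of 0 1] n3 show False by auto
  qed
  moreover have "{1..<2} = {1::nat}" by auto
  ultimately show ?thesis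
    unfolding is_critical_index_def num_weights_def gap_instance_weights by simp
qed

section \<open>The Lagrangian bound\<close>

lemma UB_gap_instance_finite: "UB (gap_instance n) 2 < \<infinity>"
proof -
  let ?L = "lagrangian (gap_instance n) 0 ` {R. R \<subseteq> {..<n}}"
  have "Max ?L < \<infinity>"
    using val_gap_instance_finite by (subst Max_less_iff) (auto simp: lagrangian_def)
  then have "dual_value (gap_instance n) 2 0 < \<infinity>"
    using gap_instance_edges_upto(1) by (simp add: dual_value_def)
  then show ?thesis
    unfolding UB_def by (intro le_less_trans[OF INF_lower]) auto
qed

text \<open>The sets \<open>{}\<close> and \<open>{..<n}\<close> bound the dual value below by two
  affine functions of \<open>l\<close>, of slopes \<open>?B\<close> and \<open>?B - n\<close>. The
  first is nondecreasing, the second nonincreasing, so their maximum is least where they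
  cross.\<close>

lemma UB_gap_instance_ge:
  "ereal ((3 - 3 / real n) * (real n - 1) / real n) \<le> UB (gap_instance n) 2"
  unfolding UB_def
proof (rule INF_greatest)
  fix l :: real assume "l \<in> {0..}"
  let ?I = "gap_instance n" and ?B = "3 - 3 / real n"
  have lag: "ereal (l * ?B + x) \<le> dual_value ?I 2 l"
    if "R \<subseteq> {..<n}" "ereal x \<le> lagrangian ?I l R" for R x
  proof -
    have "lagrangian ?I l R \<le> Max (lagrangian ?I l ` {R. R \<subseteq> {..<n}})"
      using that(1) by (intro Max_ge) auto
    with that(2) have "ereal (l * ?B) + ereal x \<le>
        ereal (l * ?B) + Max (lagrangian ?I l ` {R. R \<subseteq> {..<n}})"
      by (intro add_left_mono) auto
    then show ?thesis using gap_instance_edges_upto(1) by (simp add: dual_value_def)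
  qed
  have "ereal 0 \<le> val ?I {}" by (rule val_geI) (auto intro!: sum_nonneg)
  then have none: "ereal (l * ?B + 0) \<le> dual_value ?I 2 l"
    by (intro lag[of "{}"]) (auto simp: lagrangian_def total_cost_def)
  have "total_cost ?I {..<n} = real n" by (simp add: total_cost_def)
  then have "ereal (real n - 1 - l * real n) \<le> lagrangian ?I l {..<n}"
    using ereal_minus_mono[OF val_gap_instance_all_light order_refl, of "ereal (l * real n)"]
    by (simp add: lagrangian_def)
  then have all: "ereal (l * ?B + (real n - 1 - l * real n)) \<le> dual_value ?I 2 l"
    by (intro lag[of "{..<n}"]) auto
  \<comment> \<open>This is the crossing multiplier, where both bounds equal \<open>?B * ?r\<close>.
    Above it \<open>{}\<close> gives the estimate, below it \<open>{..<n}\<close> does.\<close>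
  let ?r = "(real n - 1) / real n"
  have n: "?r * real n = real n - 1" using n3 by simp
  have "0 \<le> 3 / real n" "3 / real n \<le> 1" "3 \<le> real n" using n3 by auto
  then have B: "0 \<le> ?B" "?B \<le> real n" by linarith+
  show "ereal (?B * (real n - 1) / real n) \<le> dual_value ?I 2 l"
  proof (cases "?r \<le> l")
    case True
    then have "?r * ?B \<le> l * ?B" using B(1) by (rule mult_right_mono)
    then have "?B * ?r \<le> l * ?B + 0" by (simp add: mult.commute)
    with none show ?thesis by (auto intro: order_trans[rotated])
  next
    case False
    then have "0 \<le> (?r - l) * (real n - ?B)" using B(2) by (intro mult_nonneg_nonneg) auto
    then have "?B * ?r \<le> l * ?B + (?r * real n - l * real n)" by (simp only: algebra_simps)
    with all show ?thesis unfolding n by (auto intro: order_trans[rotated])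
  qed
qed

end

theorem theorem4p10:
  fixes \<epsilon> :: real
  assumes "\<epsilon> > 0"
  shows "\<exists>(I :: (nat, nat) mst_interdiction) k.
           is_instance I \<and> is_critical_index I k \<and>
           0 < OPT I \<and> UB I k < \<infinity> \<and>
           UB I k / OPT I \<ge> ereal (3 - \<epsilon>)"
proof -
  \<comment> \<open>The bound on \<open>UB\<close> expands to \<open>3 - 6/n + 3/n^2\<close>, so
    \<open>6/n < \<epsilon>\<close> suffices.\<close>
  obtain m :: nat where m: "6 / \<epsilon> < real m" using reals_Archimedean2 by blast
  define n where "n = max 3 m"
  have n3: "3 \<le> n" by (simp add: n_def)
  have "6 / \<epsilon> < real n" using m by (simp add: n_def)
  then have "6 / real n < \<epsilon>" using assms n3 by (simp add: field_simps)
  moreover have "(3 - 3 / real n) * (real n - 1) / real n = 3 - 6 / real n + 3 / (real n)\<^sup>2"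
    using n3 by (simp add: field_simps power2_eq_square)
  moreover have "0 \<le> 3 / (real n)\<^sup>2" by simp
  ultimately have "3 - \<epsilon> \<le> (3 - 3 / real n) * (real n - 1) / real n" by linarith
  \<comment> \<open>Since \<open>OPT\<close> equals 1, the ratio is \<open>UB\<close>
    itself.\<close>
  then have "ereal (3 - \<epsilon>) \<le> UB (gap_instance n) 2"
    using UB_gap_instance_ge[OF n3] by (auto intro: order_trans[rotated])
  then show ?thesis
    using is_instance_gap_instance[OF n3] gap_instance_critical_index[OF n3]
      OPT_gap_instance[OF n3] UB_gap_instance_finite[OF n3]
    by (intro exI[of _ "gap_instance n"] exI[of _ 2]) (simp add: one_ereal_def divide_ereal_def)
qed

end
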